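(* For every integer $n\ge 0$, the negabicomplex Pell and negabicomplex Pell-Lucas numbers satisfy $$BP_{-n}=(-1)^{n+1}\,BP_n+(-1)^n\,Q_n\,(i+2j+5ij)$$ and $$BPL_{-n}=(-1)^n\,BPL_n+8\,(-1)^{n+1}\,P_n\,(i+2j+5ij).$$
   Context: The bicomplex numbers $\mathbb{C}_2=\{q_1+iq_2+jq_3+ijq_4 : q_1,q_2,q_3,q_4\in\mathbb{R}\}$ form the commutative associative real algebra with basis $1,i,j,ij$ and multiplication determined by $i^2=-1$, $j^2=-1$, $ij=ji$ (so $(ij)^2=1$). The Pell numbers are given by $P_0=0$, $P_1=1$, $P_n=2P_{n-1}+P_{n-2}$ and the Pell-Lucas numbers by $Q_0=2$, $Q_1=2$, $Q_n=2Q_{n-1}+Q_{n-2}$; both sequences are extended to all integer indices by the recurrence, i.e. $P_{-n}=(-1)^{n+1}P_n$ and $Q_{-n}=(-1)^nQ_n$. For every integer $n$, the bicomplex Pell and bicomplex Pell-Lucas numbers are $BP_n=P_n+iP_{n+1}+jP_{n+2}+ijP_{n+3}$ and $BPL_n=Q_n+iQ_{n+1}+jQ_{n+2}+ijQ_{n+3}$; those with negative index are called negabicomplex. *)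

theory Defs
  imports Complex_Main
begin

text \<open>\<open>Bicomplex a b c d\<close> stands for \<open>a + i b + j c + ij d\<close>; see \<open>bicomplex_expand\<close> below.\<close>

datatype bicomplex = Bicomplex (bc1: real) (bci: real) (bcj: real) (bcij: real)

lemma bicomplex_eq_iff:
  "x = y \<longleftrightarrow> bc1 x = bc1 y \<and> bci x = bci y \<and> bcj x = bcj y \<and> bcij x = bcij y"
  by (cases x; cases y) auto

instantiation bicomplex :: comm_ring_1
begin

definition zero_bicomplex :: bicomplex
  where "0 = Bicomplex 0 0 0 0"

definition one_bicomplex :: bicomplex
  where "1 = Bicomplex 1 0 0 0"

definition plus_bicomplex :: "bicomplex \<Rightarrow> bicomplex \<Rightarrow> bicomplex"
  where "x + y = Bicomplex (bc1 x + bc1 y) (bci x + bci y) (bcj x + bcj y) (bcij x + bcij y)"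

definition uminus_bicomplex :: "bicomplex \<Rightarrow> bicomplex"
  where "- x = Bicomplex (- bc1 x) (- bci x) (- bcj x) (- bcij x)"

definition minus_bicomplex :: "bicomplex \<Rightarrow> bicomplex \<Rightarrow> bicomplex"
  where "x - y = Bicomplex (bc1 x - bc1 y) (bci x - bci y) (bcj x - bcj y) (bcij x - bcij y)"

text \<open>The bilinear product determined by \<open>i\<^sup>2 = j\<^sup>2 = -1\<close> and \<open>ij = ji\<close>.\<close>

definition times_bicomplex :: "bicomplex \<Rightarrow> bicomplex \<Rightarrow> bicomplex"
  where "x * y = Bicomplex
    (bc1 x * bc1 y - bci x * bci y - bcj x * bcj y + bcij x * bcij y)
    (bc1 x * bci y + bci x * bc1 y - bcj x * bcij y - bcij x * bcj y)
    (bc1 x * bcj y + bcj x * bc1 y - bci x * bcij y - bcij x * bci y)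
    (bc1 x * bcij y + bcij x * bc1 y + bci x * bcj y + bcj x * bci y)"

instance
  by standard
    (simp_all add: bicomplex_eq_iff zero_bicomplex_def one_bicomplex_def plus_bicomplex_def
      uminus_bicomplex_def minus_bicomplex_def times_bicomplex_def algebra_simps)

end

instantiation bicomplex :: real_algebra_1
begin

definition scaleR_bicomplex :: "real \<Rightarrow> bicomplex \<Rightarrow> bicomplex"
  where "r *\<^sub>R x = Bicomplex (r * bc1 x) (r * bci x) (r * bcj x) (r * bcij x)"

instance
  by standard
    (simp_all add: bicomplex_eq_iff plus_bicomplex_def times_bicomplex_def
      scaleR_bicomplex_def algebra_simps)

end

definition bi_i :: bicomplex
  where "bi_i = Bicomplex 0 1 0 0"

definition bi_j :: bicomplex
  where "bi_j = Bicomplex 0 0 1 0"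

lemma bi_i_squared: "bi_i\<^sup>2 = - 1"
  by (simp add: power2_eq_square bi_i_def times_bicomplex_def uminus_bicomplex_def
      one_bicomplex_def)

lemma bi_j_squared: "bi_j\<^sup>2 = - 1"
  by (simp add: power2_eq_square bi_j_def times_bicomplex_def uminus_bicomplex_def
      one_bicomplex_def)

lemma bicomplex_expand:
  "Bicomplex a b c d =
     of_real a + bi_i * of_real b + bi_j * of_real c + bi_i * bi_j * of_real d"
  by (simp add: of_real_def scaleR_bicomplex_def bi_i_def bi_j_def times_bicomplex_def
      plus_bicomplex_def one_bicomplex_def)

text \<open>The two-sided Pell sequences: for \<open>n < 0\<close> the recurrence is solved for its lowest term,
  \<open>P\<^sub>n = P\<^sub>n\<^sub>+\<^sub>2 - 2 P\<^sub>n\<^sub>+\<^sub>1\<close>.\<close>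

function pell :: "int \<Rightarrow> int"
  where "pell n =
    (if n = 0 then 0
     else if n = 1 then 1
     else if n \<ge> 2 then 2 * pell (n - 1) + pell (n - 2)
     else pell (n + 2) - 2 * pell (n + 1))"
  by pat_completeness auto
termination by (relation "measure (\<lambda>n. nat \<bar>2 * n - 1\<bar>)") auto

function pell_lucas :: "int \<Rightarrow> int"
  where "pell_lucas n =
    (if n = 0 then 2
     else if n = 1 then 2
     else if n \<ge> 2 then 2 * pell_lucas (n - 1) + pell_lucas (n - 2)
     else pell_lucas (n + 2) - 2 * pell_lucas (n + 1))"
  by pat_completeness auto
termination by (relation "measure (\<lambda>n. nat \<bar>2 * n - 1\<bar>)") auto

declare pell.simps [simp del] pell_lucas.simps [simp del]

lemma pell_0: "pell 0 = 0" and pell_1: "pell 1 = 1"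
  by (simp_all add: pell.simps)

lemma pell_lucas_0: "pell_lucas 0 = 2" and pell_lucas_1: "pell_lucas 1 = 2"
  by (simp_all add: pell_lucas.simps)

lemma pell_rec: "pell n = 2 * pell (n - 1) + pell (n - 2)"
proof (cases "n \<ge> 2")
  case True
  then show ?thesis by (subst pell.simps) simp
next
  case False
  then have "pell (n - 2) = pell n - 2 * pell (n - 1)"
    by (subst pell.simps) simp
  then show ?thesis by simp
qed

lemma pell_lucas_rec: "pell_lucas n = 2 * pell_lucas (n - 1) + pell_lucas (n - 2)"
proof (cases "n \<ge> 2")
  case True
  then show ?thesis by (subst pell_lucas.simps) simp
next
  case False
  then have "pell_lucas (n - 2) = pell_lucas n - 2 * pell_lucas (n - 1)"
    by (subst pell_lucas.simps) simp
  then show ?thesis by simp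
qed

lemma pell_neg: "pell (- int n) = (- 1) ^ (n + 1) * pell (int n)"
proof (induction n rule: less_induct)
  case (less n)
  consider "n = 0" | "n = 1" | m where "n = Suc (Suc m)"
    by (metis One_nat_def not0_implies_Suc)
  then show ?case
  proof cases
    case 1
    then show ?thesis by (simp add: pell_0)
  next
    case 2
    then show ?thesis using pell_rec [of 1] by (simp add: pell_0 pell_1)
  next
    case 3
    have "pell (- int m - 1) = (- 1) ^ m * pell (1 + int m)"
      "pell (- int m) = - ((- 1) ^ m * pell (int m))"
      using less [of "Suc m"] less [of m] 3 by (simp_all add: minus_diff_commute)
    then show ?thesis
      using 3 pell_rec [of "- int m"] pell_rec [of "int m + 2"]
      by (simp add: algebra_simps)
  qed
qed

lemma pell_lucas_neg: "pell_lucas (- int n) = (- 1) ^ n * pell_lucas (int n)"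
proof (induction n rule: less_induct)
  case (less n)
  consider "n = 0" | "n = 1" | m where "n = Suc (Suc m)"
    by (metis One_nat_def not0_implies_Suc)
  then show ?case
  proof cases
    case 1
    then show ?thesis by simp
  next
    case 2
    then show ?thesis using pell_lucas_rec [of 1] by (simp add: pell_lucas_0 pell_lucas_1)
  next
    case 3
    have "pell_lucas (- int m - 1) = - ((- 1) ^ m * pell_lucas (1 + int m))"
      "pell_lucas (- int m) = (- 1) ^ m * pell_lucas (int m)"
      using less [of "Suc m"] less [of m] 3 by (simp_all add: minus_diff_commute)
    then show ?thesis
      using 3 pell_lucas_rec [of "- int m"] pell_lucas_rec [of "int m + 2"]
      by (simp add: algebra_simps)
  qed
qed

definition bicomplex_pell :: "int \<Rightarrow> bicomplex"
  where "bicomplex_pell n =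
    of_int (pell n) + bi_i * of_int (pell (n + 1)) + bi_j * of_int (pell (n + 2))
      + bi_i * bi_j * of_int (pell (n + 3))"

definition bicomplex_pell_lucas :: "int \<Rightarrow> bicomplex"
  where "bicomplex_pell_lucas n =
    of_int (pell_lucas n) + bi_i * of_int (pell_lucas (n + 1))
      + bi_j * of_int (pell_lucas (n + 2)) + bi_i * bi_j * of_int (pell_lucas (n + 3))"

end

theory Submission
  imports Defs
begin

text \<open>The \<open>k\<close>-th coordinate (\<open>k = 0, 1, 2, 3\<close>) of a negabicomplex number is the term of index
  \<open>k - n\<close>, while the same coordinate of \<open>BP\<^sub>n\<close> or \<open>BPL\<^sub>n\<close> is the term of index \<open>n + k\<close>, which is
  not its reflection unless \<open>k = 0\<close>.  The two terms are related by
  \<open>P\<^sub>k\<^sub>-\<^sub>n = (-1)\<^sup>n\<^sup>+\<^sup>1 P\<^sub>n\<^sub>+\<^sub>k + (-1)\<^sup>n Q\<^sub>n P\<^sub>k\<close> and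
  \<open>Q\<^sub>k\<^sub>-\<^sub>n = (-1)\<^sup>n Q\<^sub>n\<^sub>+\<^sub>k + 8 (-1)\<^sup>n\<^sup>+\<^sup>1 P\<^sub>n P\<^sub>k\<close>.
  For fixed \<open>n\<close>, each side of either identity solves the recurrence
  \<open>x\<^sub>k\<^sub>+\<^sub>2 = 2 x\<^sub>k\<^sub>+\<^sub>1 + x\<^sub>k\<close>, so it is enough to compare the two sides at \<open>k = 0\<close>, where \<open>P\<^sub>0 = 0\<close>
  leaves the reflection formula, and at \<open>k = 1\<close>, where the correction comes from
  \<open>Q\<^sub>n = P\<^sub>n\<^sub>+\<^sub>1 + P\<^sub>n\<^sub>-\<^sub>1\<close> and \<open>8 P\<^sub>n = Q\<^sub>n\<^sub>+\<^sub>1 + Q\<^sub>n\<^sub>-\<^sub>1\<close>.  The bicomplex factor \<open>i + 2j + 5ij\<close>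
  therefore consists of \<open>P\<^sub>0, P\<^sub>1, P\<^sub>2, P\<^sub>3 = 0, 1, 2, 5\<close>.\<close>

lemma pell_recurrence_unique:
  fixes f g :: "nat \<Rightarrow> int"
  assumes "f 0 = g 0" "f 1 = g 1"
    and "\<And>k. f (k + 2) = 2 * f (k + 1) + f k"
    and "\<And>k. g (k + 2) = 2 * g (k + 1) + g k"
  shows "f k = g k"
proof -
  have "f k = g k \<and> f (k + 1) = g (k + 1)"
    by (induction k) (use assms in \<open>simp_all add: numeral_2_eq_2\<close>)
  then show ?thesis ..
qed

lemma pell_step: "pell (m + 2) = 2 * pell (m + 1) + pell m"
  using pell_rec [of "m + 2"] by (simp add: add.commute)

lemma pell_lucas_step: "pell_lucas (m + 2) = 2 * pell_lucas (m + 1) + pell_lucas m"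
  using pell_lucas_rec [of "m + 2"] by (simp add: add.commute)

lemma pell_2: "pell 2 = 2" and pell_3: "pell 3 = 5"
  using pell_step [of 0] pell_step [of 1] by (simp_all add: pell_0 pell_1)

lemma pell_lucas_2: "pell_lucas 2 = 6"
  using pell_lucas_step [of 0] by (simp add: pell_lucas_0 pell_lucas_1)

text \<open>This is \<open>Q\<^sub>n = P\<^sub>n\<^sub>+\<^sub>1 + P\<^sub>n\<^sub>-\<^sub>1\<close> with \<open>P\<^sub>n\<^sub>-\<^sub>1\<close> eliminated by the recurrence, which keeps all
  indices nonnegative.\<close>

lemma pell_lucas_eq_pell_diff: "pell_lucas (int n) = 2 * (pell (int n + 1) - pell (int n))"
proof (rule pell_recurrence_unique)
  fix k
  show "pell_lucas (int (k + 2)) = 2 * pell_lucas (int (k + 1)) + pell_lucas (int k)"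
    using pell_lucas_step [of "int k"] by (simp add: add_ac)
  show "2 * (pell (int (k + 2) + 1) - pell (int (k + 2))) =
      2 * (2 * (pell (int (k + 1) + 1) - pell (int (k + 1))))
        + 2 * (pell (int k + 1) - pell (int k))"
    using pell_step [of "int k"] pell_step [of "int k + 1"] by (simp add: add_ac)
qed (simp_all add: pell_0 pell_1 pell_2 pell_lucas_0 pell_lucas_1)

text \<open>Likewise \<open>8 P\<^sub>n = Q\<^sub>n\<^sub>+\<^sub>1 + Q\<^sub>n\<^sub>-\<^sub>1\<close>, halved.\<close>

lemma pell_eq_pell_lucas_diff: "4 * pell (int n) = pell_lucas (int n + 1) - pell_lucas (int n)"
proof (rule pell_recurrence_unique)
  fix k
  show "4 * pell (int (k + 2)) = 2 * (4 * pell (int (k + 1))) + 4 * pell (int k)"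
    using pell_step [of "int k"] by (simp add: add_ac)
  show "pell_lucas (int (k + 2) + 1) - pell_lucas (int (k + 2)) =
      2 * (pell_lucas (int (k + 1) + 1) - pell_lucas (int (k + 1)))
        + (pell_lucas (int k + 1) - pell_lucas (int k))"
    using pell_lucas_step [of "int k"] pell_lucas_step [of "int k + 1"] by (simp add: add_ac)
qed (simp_all add: pell_0 pell_1 pell_lucas_0 pell_lucas_1 pell_lucas_2)

text \<open>Uniqueness is applied in \<open>k\<close> with \<open>n\<close> fixed: the signs \<open>(-1)\<^sup>n\<close> and the factor \<open>Q\<^sub>n\<close> are then
  constants, and both sides are linear combinations of shifted solutions.\<close>

lemma pell_reflect_shift:
  "pell (- int n + int k) =
    (- 1) ^ (n + 1) * pell (int n + int k) + (- 1) ^ n * pell_lucas (int n) * pell (int k)"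
proof (rule pell_recurrence_unique)
  show "pell (- int n + int 0) =
      (- 1) ^ (n + 1) * pell (int n + int 0) + (- 1) ^ n * pell_lucas (int n) * pell (int 0)"
    using pell_neg [of n] by (simp add: pell_0)
  \<comment> \<open>\<open>P\<^sub>1\<^sub>-\<^sub>n\<close> is reached from the reflections of \<open>P\<^sub>n\<close> and \<open>P\<^sub>n\<^sub>+\<^sub>1\<close>; reflecting \<open>P\<^sub>n\<^sub>-\<^sub>1\<close> instead
    would leave out \<open>n = 0\<close>.\<close>
  show "pell (- int n + int 1) =
      (- 1) ^ (n + 1) * pell (int n + int 1) + (- 1) ^ n * pell_lucas (int n) * pell (int 1)"
    using pell_rec [of "1 - int n"] pell_neg [of n] pell_neg [of "Suc n"]
    by (simp add: pell_1 pell_lucas_eq_pell_diff algebra_simps)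
  fix k
  show "pell (- int n + int (k + 2)) =
      2 * pell (- int n + int (k + 1)) + pell (- int n + int k)"
    using pell_step [of "- int n + int k"] by (simp add: algebra_simps)
  show "(- 1) ^ (n + 1) * pell (int n + int (k + 2))
        + (- 1) ^ n * pell_lucas (int n) * pell (int (k + 2)) =
      2 * ((- 1) ^ (n + 1) * pell (int n + int (k + 1))
        + (- 1) ^ n * pell_lucas (int n) * pell (int (k + 1)))
      + ((- 1) ^ (n + 1) * pell (int n + int k)
        + (- 1) ^ n * pell_lucas (int n) * pell (int k))"
    using pell_step [of "int n + int k"] pell_step [of "int k"]
    by (simp add: algebra_simps)
qed

text \<open>The correction is again a multiple of \<open>P\<^sub>k\<close>, not of \<open>Q\<^sub>k\<close>, because it must vanish at
  \<open>k = 0\<close>; hence the same bicomplex factor occurs in both parts of the theorem.\<close>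

lemma pell_lucas_reflect_shift:
  "pell_lucas (- int n + int k) =
    (- 1) ^ n * pell_lucas (int n + int k) + 8 * (- 1) ^ (n + 1) * pell (int n) * pell (int k)"
proof (rule pell_recurrence_unique)
  show "pell_lucas (- int n + int 0) =
      (- 1) ^ n * pell_lucas (int n + int 0) + 8 * (- 1) ^ (n + 1) * pell (int n) * pell (int 0)"
    using pell_lucas_neg [of n] by (simp add: pell_0)
  have "8 * pell (int n) = 2 * (pell_lucas (int n + 1) - pell_lucas (int n))"
    using pell_eq_pell_lucas_diff [of n] by simp
  then have "8 * (- 1) ^ (n + 1) * pell (int n) * pell (int 1) =
      (- 1) ^ (n + 1) * (2 * (pell_lucas (int n + 1) - pell_lucas (int n)))"
    by (simp add: pell_1)
  then show "pell_lucas (- int n + int 1) =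
      (- 1) ^ n * pell_lucas (int n + int 1) + 8 * (- 1) ^ (n + 1) * pell (int n) * pell (int 1)"
    using pell_lucas_rec [of "1 - int n"] pell_lucas_neg [of n] pell_lucas_neg [of "Suc n"]
    by (simp add: algebra_simps)
  fix k
  show "pell_lucas (- int n + int (k + 2)) =
      2 * pell_lucas (- int n + int (k + 1)) + pell_lucas (- int n + int k)"
    using pell_lucas_step [of "- int n + int k"] by (simp add: algebra_simps)
  show "(- 1) ^ n * pell_lucas (int n + int (k + 2))
        + 8 * (- 1) ^ (n + 1) * pell (int n) * pell (int (k + 2)) =
      2 * ((- 1) ^ n * pell_lucas (int n + int (k + 1))
        + 8 * (- 1) ^ (n + 1) * pell (int n) * pell (int (k + 1)))
      + ((- 1) ^ n * pell_lucas (int n + int k)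
        + 8 * (- 1) ^ (n + 1) * pell (int n) * pell (int k))"
    using pell_lucas_step [of "int n + int k"] pell_step [of "int k"]
    by (simp add: algebra_simps)
qed

theorem theorem2p6:
  fixes n :: nat
  shows
    "bicomplex_pell (- int n) =
      (- 1) ^ (n + 1) * bicomplex_pell (int n)
        + (- 1) ^ n * of_int (pell_lucas (int n)) * (bi_i + 2 * bi_j + 5 * (bi_i * bi_j))
    \<and> bicomplex_pell_lucas (- int n) =
      (- 1) ^ n * bicomplex_pell_lucas (int n)
        + 8 * (- 1) ^ (n + 1) * of_int (pell (int n)) * (bi_i + 2 * bi_j + 5 * (bi_i * bi_j))"
proof
  have P: "pell (- int n) = (- 1) ^ (n + 1) * pell (int n)"
    "pell (- int n + 1) = (- 1) ^ (n + 1) * pell (int n + 1) + (- 1) ^ n * pell_lucas (int n)"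
    "pell (- int n + 2) = (- 1) ^ (n + 1) * pell (int n + 2) + (- 1) ^ n * pell_lucas (int n) * 2"
    "pell (- int n + 3) = (- 1) ^ (n + 1) * pell (int n + 3) + (- 1) ^ n * pell_lucas (int n) * 5"
    using pell_reflect_shift [of n 0] pell_reflect_shift [of n 1]
      pell_reflect_shift [of n 2] pell_reflect_shift [of n 3]
    by (simp_all add: pell_0 pell_1 pell_2 pell_3)
  show "bicomplex_pell (- int n) =
      (- 1) ^ (n + 1) * bicomplex_pell (int n)
        + (- 1) ^ n * of_int (pell_lucas (int n)) * (bi_i + 2 * bi_j + 5 * (bi_i * bi_j))"
    unfolding bicomplex_pell_def P by (simp add: algebra_simps)
  have Q: "pell_lucas (- int n) = (- 1) ^ n * pell_lucas (int n)"
    "pell_lucas (- int n + 1) =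
      (- 1) ^ n * pell_lucas (int n + 1) + 8 * (- 1) ^ (n + 1) * pell (int n)"
    "pell_lucas (- int n + 2) =
      (- 1) ^ n * pell_lucas (int n + 2) + 8 * (- 1) ^ (n + 1) * pell (int n) * 2"
    "pell_lucas (- int n + 3) =
      (- 1) ^ n * pell_lucas (int n + 3) + 8 * (- 1) ^ (n + 1) * pell (int n) * 5"
    using pell_lucas_reflect_shift [of n 0] pell_lucas_reflect_shift [of n 1]
      pell_lucas_reflect_shift [of n 2] pell_lucas_reflect_shift [of n 3]
    by (simp_all add: pell_0 pell_1 pell_2 pell_3)
  show "bicomplex_pell_lucas (- int n) =
      (- 1) ^ n * bicomplex_pell_lucas (int n)
        + 8 * (- 1) ^ (n + 1) * of_int (pell (int n)) * (bi_i + 2 * bi_j + 5 * (bi_i * bi_j))"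
    unfolding bicomplex_pell_lucas_def Q by (simp add: algebra_simps)
qed

end
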